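(* Let $K$ be a field of characteristic zero and let $H=S(V)$ be a conilpotent right-handed polynomial Hopf algebra over $K$, where $V$ has a fixed basis $\mathcal B=\{b_i\}_{i\in X}$ with $X=\{1,\dots,n\}$ or $X=\mathbb N^\ast$. The value of the antipode $S$ of $S(V)$ on an element $b_i\in\mathcal B$ is given by the cancellation free formula $$S(b_i)=\sum_{T\in\mathcal T_i}(-1)^{l(T)}\,\lambda(T)\,v(T),$$ where cancellation free refers to the fact that each tree appears only once. Here $\mathcal T_i$ is the set of decorated trees associated to $b_i$, and $l(T)$, $\lambda(T)$, $v(T)$ are the length, the coefficient and the $b$-value of $T$.
   Context: Right-handed polynomial Hopf algebra: the polynomial algebra $S(V)$ over the vector space $V$ (free commutative algebra) equipped with a coproduct $\Delta$, with counit the projection $S(V)\to S^0(V)=K$, that makes $S(V)$ a Hopf algebra and such that $\overline\Delta(V)\subset V\otimes S(V)$, where $\overline\Delta(c)=\Delta(c)-c\otimes 1-1\otimes c$ is the reduced coproduct. Conilpotent: for every $c$ in the kernel of the counit, some iterated reduced coproduct $\overline\Delta^{[n]}(c)$ (obtained by applying $\overline\Delta$ successively $n-1$ times, each time to one tensor factor) vanishes. Structure coefficients: for a multiset $I$ over $X$ put $b_I=\prod_{i\in I}b_i$. The coefficients $\lambda^{i;i_0}_I\in K$ are defined by the expansion $\overline\Delta(b_i)=\sum_{i_0,\ I\neq\emptyset}\lambda^{i;i_0}_I\,b_{i_0}\otimes b_I$, over $i_0\in X$ and nonempty finite multisets $I$ over $X$. Decorated trees: finite rooted trees (connected and simply connected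 finite posets with a unique minimal element, the root) whose internal vertices $x$ are decorated by pairs $d(x)=(d_1(x);d_2(x))$ of positive integers (indices in $X$) and whose leaves $x$ are decorated by positive integers, written $d(x)=d_1(x)=d_2(x)$; in the tree with only one vertex, the vertex is considered as a leaf. The trees are non planar: the ordering of the branches does not matter. A forest is a commutative product of such trees. A tree is associated to $b_i$, written $T\in\mathcal T_i$, if its root is decorated by $i$ or by $(i;i_0)$ for some $i_0$. For a pair $p$, $B^+_p(T_1\cdots T_s)$ is the tree obtained by adding a common root decorated by $p$ to the trees $T_1,\dots,T_s$; $\bullet_i$ is the one-vertex tree decorated by $i$. Statistics: the length $l(T)$ is the number of vertices of $T$. The coefficient is defined by $\lambda(\bullet_i)=1$ and $\lambda(B^+_{(i;i_0)}(T_1\cdots T_s))=\lambda^{i;i_0}_{\{i_1,\dots,i_s\}}\lambda(T_1)\cdots\lambda(T_s)$ when $T_1,\dots,T_s$ are respectively associated to $b_{i_1},\dots,b_{i_s}$. The $b$-value is $v(T)=\prod_{x\in T}b_{d_2(x)}\in S(V)$, the product running over all vertices $x$ of $T$.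
   Formalization: Different branches at a vertex with the same root index are attached to distinct occurrences in I, so swapping them gives another tree (with non planar trees each counted once the formula fails for Faà di Bruno); the possibly infinite sum is taken monomial by monomial. *)

theory Defs
  imports Complex_Main "HOL-Library.Poly_Mapping" "HOL-Library.Product_Plus" "HOL-Library.Multiset"
begin

section \<open>The algebra \<open>S(V)\<close> and its tensor powers\<close>

text \<open>
  With the basis \<open>b\<^sub>i\<close> (\<open>i \<in> X\<close>) of \<open>V\<close> fixed, \<open>S(V)\<close> is the polynomial algebra in the
  variables \<open>b\<^sub>i\<close>. A monomial is its exponent function, and a polynomial is a finitely supported
  function on monomials; the library's convolution product is the product of \<open>S(V)\<close>.
  \<open>S(V) \<otimes> S(V)\<close> has the basis of pairs of monomials, and the convolution product for the
  componentwise addition of pairs is \<open>(p \<otimes> q)(p' \<otimes> q') = pp' \<otimes> qq'\<close>.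
\<close>

type_synonym monom = "nat \<Rightarrow>\<^sub>0 nat"
type_synonym 'k pol = "monom \<Rightarrow>\<^sub>0 'k"
type_synonym 'k pol2 = "(monom \<times> monom) \<Rightarrow>\<^sub>0 'k"

definition basis_vec :: "'a \<Rightarrow> ('a \<Rightarrow>\<^sub>0 'k::zero_neq_one)" where
  "basis_vec a = Poly_Mapping.single a 1"

definition scale :: "'k::semiring_0 \<Rightarrow> ('a \<Rightarrow>\<^sub>0 'k) \<Rightarrow> ('a \<Rightarrow>\<^sub>0 'k)" where
  "scale c p = Poly_Mapping.map (\<lambda>x. c * x) p"

definition lin_ext :: "('a \<Rightarrow> ('b \<Rightarrow>\<^sub>0 'k::semiring_0)) \<Rightarrow> ('a \<Rightarrow>\<^sub>0 'k) \<Rightarrow> ('b \<Rightarrow>\<^sub>0 'k)" where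
  "lin_ext f p = (\<Sum>a\<in>Poly_Mapping.keys p. scale (Poly_Mapping.lookup p a) (f a))"

definition tensor :: "('a \<Rightarrow>\<^sub>0 'k::semiring_0) \<Rightarrow> ('b \<Rightarrow>\<^sub>0 'k) \<Rightarrow> ('a \<times> 'b) \<Rightarrow>\<^sub>0 'k" where
  "tensor p q = (\<Sum>a\<in>Poly_Mapping.keys p. \<Sum>b\<in>Poly_Mapping.keys q.
     Poly_Mapping.single (a, b) (Poly_Mapping.lookup p a * Poly_Mapping.lookup q b))"

definition tensor_map ::
  "(('a \<Rightarrow>\<^sub>0 'k::semiring_1) \<Rightarrow> ('c \<Rightarrow>\<^sub>0 'k)) \<Rightarrow> (('b \<Rightarrow>\<^sub>0 'k) \<Rightarrow> ('d \<Rightarrow>\<^sub>0 'k)) \<Rightarrow>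
   (('a \<times> 'b) \<Rightarrow>\<^sub>0 'k) \<Rightarrow> (('c \<times> 'd) \<Rightarrow>\<^sub>0 'k)" where
  "tensor_map f g = lin_ext (\<lambda>(a, b). tensor (f (basis_vec a)) (g (basis_vec b)))"

definition tensor_assoc :: "((('a \<times> 'b) \<times> 'c) \<Rightarrow>\<^sub>0 'k::semiring_1) \<Rightarrow> (('a \<times> 'b \<times> 'c) \<Rightarrow>\<^sub>0 'k)" where
  "tensor_assoc = lin_ext (\<lambda>((a, b), c). basis_vec (a, b, c))"

definition monoms :: "nat set \<Rightarrow> monom set" where
  "monoms X = {m. Poly_Mapping.keys m \<subseteq> X}"

definition gen :: "nat \<Rightarrow> 'k::zero_neq_one pol" where
  "gen i = basis_vec (Poly_Mapping.single i 1)"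

definition gen_monoms :: "nat set \<Rightarrow> monom set" where
  "gen_monoms X = {Poly_Mapping.single i 1 | i. i \<in> X}"

definition S_alg :: "nat set \<Rightarrow> 'k::zero pol set" where
  "S_alg X = {p. Poly_Mapping.keys p \<subseteq> monoms X}"

definition V_space :: "nat set \<Rightarrow> 'k::zero pol set" where
  "V_space X = {p. Poly_Mapping.keys p \<subseteq> gen_monoms X}"

definition S_tensor_S :: "nat set \<Rightarrow> 'k::zero pol2 set" where
  "S_tensor_S X = {t. Poly_Mapping.keys t \<subseteq> monoms X \<times> monoms X}"

definition V_tensor_S :: "nat set \<Rightarrow> 'k::zero pol2 set" where
  "V_tensor_S X = {t. Poly_Mapping.keys t \<subseteq> gen_monoms X \<times> monoms X}"

definition linear_between ::
  "('a \<Rightarrow>\<^sub>0 'k::semiring_0) set \<Rightarrow> ('b \<Rightarrow>\<^sub>0 'k) set \<Rightarrow> (('a \<Rightarrow>\<^sub>0 'k) \<Rightarrow> ('b \<Rightarrow>\<^sub>0 'k)) \<Rightarrow> bool" where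
  "linear_between A B f \<longleftrightarrow>
     (\<forall>p\<in>A. f p \<in> B) \<and>
     (\<forall>p\<in>A. \<forall>q\<in>A. f (p + q) = f p + f q) \<and>
     (\<forall>c. \<forall>p\<in>A. f (scale c p) = scale c (f p))"


section \<open>Right-handed conilpotent polynomial Hopf algebras\<close>

text \<open>The projection on \<open>S\<^sup>0(V) = K\<close>.\<close>

definition counit :: "'k::zero pol \<Rightarrow> 'k" where
  "counit p = Poly_Mapping.lookup p 0"

text \<open>The values of the coproduct \<open>\<Delta>\<close> and of the antipode outside \<open>S_alg X\<close> are irrelevant.
  The counit is an algebra morphism for every choice of \<open>\<Delta>\<close>.\<close>

definition polynomial_bialgebra :: "nat set \<Rightarrow> ('k::comm_ring_1 pol \<Rightarrow> 'k pol2) \<Rightarrow> bool" where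
  "polynomial_bialgebra X \<Delta> \<longleftrightarrow>
     linear_between (S_alg X) (S_tensor_S X) \<Delta> \<and>
     \<Delta> 1 = 1 \<and>
     (\<forall>p\<in>S_alg X. \<forall>q\<in>S_alg X. \<Delta> (p * q) = \<Delta> p * \<Delta> q) \<and>
     (\<forall>p\<in>S_alg X. tensor_assoc (tensor_map \<Delta> id (\<Delta> p)) = tensor_map id \<Delta> (\<Delta> p)) \<and>
     (\<forall>p\<in>S_alg X. lin_ext (\<lambda>(a, b). scale (counit (basis_vec a)) (basis_vec b)) (\<Delta> p) = p) \<and>
     (\<forall>p\<in>S_alg X. lin_ext (\<lambda>(a, b). scale (counit (basis_vec b)) (basis_vec a)) (\<Delta> p) = p)"

definition is_antipode ::
  "nat set \<Rightarrow> ('k::comm_ring_1 pol \<Rightarrow> 'k pol2) \<Rightarrow> ('k pol \<Rightarrow> 'k pol) \<Rightarrow> bool" where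
  "is_antipode X \<Delta> S \<longleftrightarrow>
     linear_between (S_alg X) (S_alg X) S \<and>
     (\<forall>p\<in>S_alg X. lin_ext (\<lambda>(a, b). S (basis_vec a) * basis_vec b) (\<Delta> p) = scale (counit p) 1) \<and>
     (\<forall>p\<in>S_alg X. lin_ext (\<lambda>(a, b). basis_vec a * S (basis_vec b)) (\<Delta> p) = scale (counit p) 1)"

definition polynomial_hopf_algebra ::
  "nat set \<Rightarrow> ('k::comm_ring_1 pol \<Rightarrow> 'k pol2) \<Rightarrow> ('k pol \<Rightarrow> 'k pol) \<Rightarrow> bool" where
  "polynomial_hopf_algebra X \<Delta> S \<longleftrightarrow> polynomial_bialgebra X \<Delta> \<and> is_antipode X \<Delta> S"

definition red_coprod :: "('k::comm_ring_1 pol \<Rightarrow> 'k pol2) \<Rightarrow> 'k pol \<Rightarrow> 'k pol2" where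
  "red_coprod \<Delta> c = \<Delta> c - tensor c 1 - tensor 1 c"

definition right_handed :: "nat set \<Rightarrow> ('k::comm_ring_1 pol \<Rightarrow> 'k pol2) \<Rightarrow> bool" where
  "right_handed X \<Delta> \<longleftrightarrow> (\<forall>c\<in>V_space X. red_coprod \<Delta> c \<in> V_tensor_S X)"

text \<open>The \<open>n\<close>-th tensor power of \<open>S(V)\<close> is spanned by the words of \<open>n\<close> monomials.
  \<open>red_coprod_at \<Delta> k\<close> applies the reduced coproduct to the tensor factor at position \<open>k\<close>
  (counted from 0).\<close>

definition red_coprod_at ::
  "('k::comm_ring_1 pol \<Rightarrow> 'k pol2) \<Rightarrow> nat \<Rightarrow> (monom list \<Rightarrow>\<^sub>0 'k) \<Rightarrow> (monom list \<Rightarrow>\<^sub>0 'k)" where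
  "red_coprod_at \<Delta> k =
     lin_ext (\<lambda>w. lin_ext (\<lambda>(a, b). basis_vec (take k w @ [a, b] @ drop (Suc k) w))
       (red_coprod \<Delta> (basis_vec (w ! k))))"

text \<open>\<open>iter_red_coprod \<Delta> ks c\<close> is \<open>c\<close> after \<open>n - 1 = length ks\<close> successive applications of the
  reduced coproduct, the \<open>j\<close>-th one (counted from 0, acting on words of length \<open>j + 1\<close>) to the
  factor at position \<open>ks ! j \<le> j\<close>.\<close>

definition iter_red_coprod ::
  "('k::comm_ring_1 pol \<Rightarrow> 'k pol2) \<Rightarrow> nat list \<Rightarrow> 'k pol \<Rightarrow> (monom list \<Rightarrow>\<^sub>0 'k)" where
  "iter_red_coprod \<Delta> ks c = fold (red_coprod_at \<Delta>) ks (lin_ext (\<lambda>m. basis_vec [m]) c)"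

text \<open>By coassociativity the choice of the positions does not matter.\<close>

definition conilpotent :: "nat set \<Rightarrow> ('k::comm_ring_1 pol \<Rightarrow> 'k pol2) \<Rightarrow> bool" where
  "conilpotent X \<Delta> \<longleftrightarrow>
     (\<forall>c\<in>S_alg X. counit c = 0 \<longrightarrow>
        (\<exists>ks. (\<forall>j<length ks. ks ! j \<le> j) \<and> iter_red_coprod \<Delta> ks c = 0))"


section \<open>Structure coefficients\<close>

definition mset_monom :: "nat multiset \<Rightarrow> monom" where
  "mset_monom I = (\<Sum>i\<in>#I. Poly_Mapping.single i 1)"

lemma basis_vec_mset_monom:
  "basis_vec (mset_monom I) = (\<Prod>i\<in>#I. gen i :: 'k::comm_ring_1 pol)"
proof (induction I)
  case empty
  show ?case by (simp add: mset_monom_def basis_vec_def flip: single_one)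
next
  case (add i I)
  have "basis_vec (mset_monom (add_mset i I)) = gen i * (basis_vec (mset_monom I) :: 'k pol)"
    by (simp add: mset_monom_def basis_vec_def gen_def mult_single)
  with add show ?case by simp
qed

lemma tensor_basis_vec:
  "tensor (basis_vec a) (basis_vec b) = (basis_vec (a, b) :: _ \<Rightarrow>\<^sub>0 'k::comm_ring_1)"
  by (simp add: tensor_def basis_vec_def)

text \<open>The coefficient of \<open>b\<^bsub>i\<^sub>0\<^esub> \<otimes> b\<^sub>I\<close> in the reduced coproduct of \<open>b\<^sub>i\<close>; by the two preceding lemmas
  these tensors are basis vectors of \<open>S(V) \<otimes> S(V)\<close>.\<close>

definition struct_coeff ::
  "('k::comm_ring_1 pol \<Rightarrow> 'k pol2) \<Rightarrow> nat \<Rightarrow> nat \<Rightarrow> nat multiset \<Rightarrow> 'k" where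
  "struct_coeff \<Delta> i i0 I =
     Poly_Mapping.lookup (red_coprod \<Delta> (gen i)) (mset_monom {#i0#}, mset_monom I)"


section \<open>Decorated trees\<close>

text \<open>\<open>Node i i0 [T\<^sub>1, \<dots>, T\<^sub>s]\<close> is the tree obtained by grafting \<open>T\<^sub>1, \<dots>, T\<^sub>s\<close> on a root decorated by
  \<open>(i; i0)\<close>.\<close>

datatype dtree = Leaf nat | Node nat nat "dtree list"

fun root_index :: "dtree \<Rightarrow> nat" where
  "root_index (Leaf i) = i"
| "root_index (Node i i0 Ts) = i"

text \<open>
  Trees are non planar: the branches at a vertex, associated to the elements of a multiset
  \<open>I = {i\<^sub>1, \<dots>, i\<^sub>s}\<close>, have no order of their own, and each choice of them is represented once, by
  listing \<open>I\<close> in increasing order. The elements of \<open>I\<close> are occurrences of indices: when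
  \<open>i\<^sub>k = i\<^sub>l\<close>, the branches grafted on the \<open>k\<close>-th and on the \<open>l\<close>-th occurrence are told apart, so
  that exchanging two different such branches gives another tree. Identifying these trees too
  would drop multiplicities: in \<open>S(b\<^sub>i)\<close> the factor \<open>S(b\<^sub>j)\<^sup>2\<close> that comes with \<open>I = {j, j}\<close> is the
  sum over the ordered pairs of trees associated to \<open>b\<^sub>j\<close>.
\<close>

fun decorated_tree :: "nat set \<Rightarrow> dtree \<Rightarrow> bool" where
  "decorated_tree X (Leaf i) \<longleftrightarrow> i \<in> X"
| "decorated_tree X (Node i i0 Ts) \<longleftrightarrow>
     i \<in> X \<and> i0 \<in> X \<and> Ts \<noteq> [] \<and> sorted (map root_index Ts) \<and> (\<forall>T\<in>set Ts. decorated_tree X T)"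

definition trees_of :: "nat set \<Rightarrow> nat \<Rightarrow> dtree set" where
  "trees_of X i = {T. decorated_tree X T \<and> root_index T = i}"

fun tree_length :: "dtree \<Rightarrow> nat" where
  "tree_length (Leaf i) = 1"
| "tree_length (Node i i0 Ts) = 1 + sum_list (map tree_length Ts)"

fun tree_coeff :: "('k::comm_ring_1 pol \<Rightarrow> 'k pol2) \<Rightarrow> dtree \<Rightarrow> 'k" where
  "tree_coeff \<Delta> (Leaf i) = 1"
| "tree_coeff \<Delta> (Node i i0 Ts) =
     struct_coeff \<Delta> i i0 (mset (map root_index Ts)) * prod_list (map (tree_coeff \<Delta>) Ts)"

fun b_value :: "dtree \<Rightarrow> 'k::comm_ring_1 pol" where
  "b_value (Leaf i) = gen i"
| "b_value (Node i i0 Ts) = gen i0 * prod_list (map b_value Ts)"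


section \<open>Sums over infinite sets of trees\<close>

text \<open>
  The set of trees associated to \<open>b\<^sub>i\<close> is infinite. For a basis that is not adapted to the
  coradical filtration, infinitely many of them may have a nonzero coefficient: take
  \<open>K[x, z]\<close> with \<open>x\<close> primitive and reduced coproduct \<open>x \<otimes> x\<close> of \<open>z\<close>, and the basis
  \<open>b\<^sub>1 = x + z\<close>, \<open>b\<^sub>2 = z\<close>, for which \<open>b\<^sub>2 \<otimes> b\<^sub>2\<close> occurs in the reduced coproduct of \<open>b\<^sub>2\<close>.
  The sum is therefore the unordered sum of formal power series: every monomial occurs in finitely
  many terms, and the coefficients are added up monomial by monomial. For families with finitely
  many nonzero terms it is the ordinary sum.
\<close>

definition has_formal_sum ::
  "('t \<Rightarrow> ('a \<Rightarrow>\<^sub>0 'k::comm_monoid_add)) \<Rightarrow> 't set \<Rightarrow> ('a \<Rightarrow>\<^sub>0 'k) \<Rightarrow> bool" where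
  "has_formal_sum f A s \<longleftrightarrow>
     (\<forall>m. finite {t\<in>A. Poly_Mapping.lookup (f t) m \<noteq> 0} \<and>
          Poly_Mapping.lookup s m =
            (\<Sum>t | t \<in> A \<and> Poly_Mapping.lookup (f t) m \<noteq> 0. Poly_Mapping.lookup (f t) m))"

lemma has_formal_sum_finite:
  assumes "finite {t\<in>A. f t \<noteq> 0}"
  shows "has_formal_sum f A s \<longleftrightarrow> s = (\<Sum>t | t \<in> A \<and> f t \<noteq> 0. f t)"
proof -
  have sub: "{t\<in>A. Poly_Mapping.lookup (f t) m \<noteq> 0} \<subseteq> {t\<in>A. f t \<noteq> 0}" for m
    by auto
  have "(\<Sum>t | t \<in> A \<and> Poly_Mapping.lookup (f t) m \<noteq> 0. Poly_Mapping.lookup (f t) m) =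
        Poly_Mapping.lookup (\<Sum>t | t \<in> A \<and> f t \<noteq> 0. f t) m" for m
    unfolding lookup_sum by (rule sum.mono_neutral_left) (use assms in auto)
  then show ?thesis
    using finite_subset[OF sub assms] by (auto simp: has_formal_sum_def poly_mapping_eq_iff fun_eq_iff)
qed

end

theory Submission
  imports Defs
begin

text \<open>
  The antipode is a two-sided convolution inverse of the identity, so applying
  \<open>id * S = \<eta>\<epsilon>\<close> to a generator and expanding the reduced coproduct gives
  \<open>S(b\<^sub>i) = - b\<^sub>i - (\<Sum>(i\<^sub>0, I). \<lambda>(i; i\<^sub>0, I) b\<^bsub>i\<^sub>0\<^esub> S(b\<^sub>I))\<close>,
  where \<open>\<lambda>(i; i\<^sub>0, I)\<close> is the structure coefficient.
  Suppose that \<open>S(b\<^sub>I)\<close> is the product of the \<open>S(b\<^sub>k)\<close>, \<open>k \<in> I\<close>. Then this is a recursion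
  for the family of the \<open>S(b\<^sub>i)\<close>, and the sum over trees solves the same recursion: a tree
  associated to \<open>b\<^sub>i\<close> is a single vertex or arises by grafting a tree for each element of \<open>I\<close>
  onto a root \<open>(i; i\<^sub>0)\<close>, and every new vertex contributes a sign and a structure coefficient.

  Multiplicativity of \<open>S\<close> uses right-handedness (\<open>antipode_monomial\<close>). Let \<open>S'\<close> be the algebra
  morphism that agrees with \<open>S\<close> on generators. The left factors in the coproduct of a generator
  have degree at most one, where \<open>S\<close> and \<open>S'\<close> agree; hence \<open>S' * id\<close>
  kills every generator. Being an algebra morphism, it equals \<open>\<eta>\<epsilon>\<close>, so that
  \<open>S' = S' * (id * S) = (S' * id) * S = S\<close>. The recursion itself is \<open>antipode_gen\<close>.

  The recursion may involve infinitely many trees, and uniqueness of its solution comes from the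
  degree: the factor \<open>b\<^bsub>i\<^sub>0\<^esub>\<close> has degree one, so the components of degree at most \<open>d\<close> of all
  \<open>S(b\<^sub>k)\<close> fix the component of degree \<open>d + 1\<close> of \<open>S(b\<^sub>i)\<close>. Unfolding the recursion \<open>h\<close> times
  yields a sum over finitely many trees, of height at most \<open>h\<close>, that agrees with \<open>S(b\<^sub>i)\<close> in
  degrees less than \<open>h\<close> (\<open>antipode_agrees_with_trees_upto\<close>). As the \<open>b\<close>-value of a tree is a
  monomial whose degree is the number of vertices, and the height is at most this number, a given
  monomial receives all its contributions from these finitely many trees once \<open>h\<close> exceeds its
  degree (\<open>in_trees_upto\<close>).
\<close>

abbreviation "lookup \<equiv> Poly_Mapping.lookup"
abbreviation "keys \<equiv> Poly_Mapping.keys"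

section \<open>Linear extensions\<close>

lemma lookup_scale [simp]: "lookup (scale c p) m = c * lookup p m"
  by (simp add: scale_def Poly_Mapping.map.rep_eq when_def)

lemma keys_scale: "keys (scale c p) \<subseteq> keys p"
  by (auto simp: in_keys_iff)

lemma scale_zero_left [simp]: "scale 0 p = 0"
  by (rule poly_mapping_eqI) simp

lemma scale_one [simp]: "scale (1 :: 'k::semiring_1) p = p"
  by (rule poly_mapping_eqI) simp

lemma scale_scale: "scale c (scale d p) = scale (c * d) p"
  by (rule poly_mapping_eqI) (simp add: mult.assoc)

lemma scale_add_left: "scale (c + d) p = scale c p + scale d p"
  by (rule poly_mapping_eqI) (simp add: lookup_add distrib_right)

lemma scale_minus: "scale (- c :: 'k::comm_ring_1) p = - scale c p"
  by (rule poly_mapping_eqI) simp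

lemma scale_diff: "scale c (p - q :: 'a \<Rightarrow>\<^sub>0 'k::comm_ring_1) = scale c p - scale c q"
  by (rule poly_mapping_eqI) (simp add: lookup_minus right_diff_distrib)

lemma scale_sum: "scale c (\<Sum>a\<in>A. f a) = (\<Sum>a\<in>A. scale c (f a))"
  by (rule poly_mapping_eqI) (simp add: lookup_sum sum_distrib_left)

lemma scale_conv_mult:
  fixes p :: "'a::monoid_add \<Rightarrow>\<^sub>0 'k::comm_ring_1"
  shows "scale c p = Poly_Mapping.single 0 c * p"
  by (simp add: scale_def mult_map_scale_conv_mult)

lemma scale_mult_left:
  fixes p :: "'a::comm_monoid_add \<Rightarrow>\<^sub>0 'k::comm_ring_1"
  shows "scale c p * q = scale c (p * q)"
  by (simp add: scale_conv_mult mult.assoc)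

lemma scale_mult_right:
  fixes p :: "'a::comm_monoid_add \<Rightarrow>\<^sub>0 'k::comm_ring_1"
  shows "p * scale c q = scale c (p * q)"
  by (simp add: scale_conv_mult mult.left_commute)

lemma lin_ext_superset:
  assumes "finite A" "keys p \<subseteq> A"
  shows "lin_ext f p = (\<Sum>a\<in>A. scale (lookup p a) (f a))"
  unfolding lin_ext_def using assms
  by (intro sum.mono_neutral_left) (auto simp: in_keys_iff)

lemma lin_ext_zero [simp]: "lin_ext f 0 = 0"
  by (simp add: lin_ext_def)

lemma lin_ext_add: "lin_ext f (p + q) = lin_ext f p + lin_ext f q"
proof -
  let ?A = "keys p \<union> keys q"
  have "keys (p + q) \<subseteq> ?A" by (rule keys_add)
  then show ?thesis
    by (simp add: lin_ext_superset[of ?A] lookup_add scale_add_left sum.distrib)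
qed

lemma lin_ext_scale: "lin_ext f (scale c p) = scale c (lin_ext f p)"
  using keys_scale[of c p]
  by (simp add: lin_ext_superset[of "keys p"] scale_sum scale_scale)

lemma lin_ext_sum: "lin_ext f (\<Sum>a\<in>A. g a) = (\<Sum>a\<in>A. lin_ext f (g a))"
  by (induction A rule: infinite_finite_induct) (auto simp: lin_ext_add)

lemma lin_ext_single [simp]: "lin_ext f (Poly_Mapping.single a c) = scale c (f a)"
  by (simp add: lin_ext_superset[of "{a}"])

lemma lin_ext_basis_vec [simp]: "lin_ext f (basis_vec a) = (f a :: _ \<Rightarrow>\<^sub>0 'k::comm_ring_1)"
  by (simp add: basis_vec_def)

lemma lin_ext_lin_ext: "lin_ext f (lin_ext g p) = lin_ext (\<lambda>a. lin_ext f (g a)) p"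
  by (simp add: lin_ext_def[of g] lin_ext_def[of "\<lambda>a. lin_ext f (g a)"] lin_ext_sum lin_ext_scale)

lemma lin_ext_tensor:
  fixes f :: "'a \<times> 'b \<Rightarrow> ('c \<Rightarrow>\<^sub>0 'k::comm_ring_1)"
  shows "lin_ext f (tensor p q) = lin_ext (\<lambda>a. lin_ext (\<lambda>b. f (a, b)) q) p"
  by (simp add: tensor_def lin_ext_sum lin_ext_def[of _ p] lin_ext_def[of _ q] scale_sum scale_scale)

lemma lin_ext_cong:
  "(\<And>a. a \<in> keys p \<Longrightarrow> f a = g a) \<Longrightarrow> lin_ext f p = lin_ext g p"
  by (simp add: lin_ext_def)

lemma lin_ext_mult_right:
  fixes q :: "'a::comm_monoid_add \<Rightarrow>\<^sub>0 'k::comm_ring_1"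
  shows "lin_ext (\<lambda>a. f a * q) p = lin_ext f p * q"
  by (simp add: lin_ext_def sum_distrib_right scale_mult_left)

lemma lin_ext_mult_left:
  fixes q :: "'a::comm_monoid_add \<Rightarrow>\<^sub>0 'k::comm_ring_1"
  shows "lin_ext (\<lambda>a. q * f a) p = q * lin_ext f p"
  by (simp add: lin_ext_def sum_distrib_left scale_mult_right)

lemma lin_ext_basis: "lin_ext basis_vec p = (p :: _ \<Rightarrow>\<^sub>0 'k::comm_ring_1)"
proof (rule poly_mapping_eqI)
  fix m
  have "lookup (lin_ext basis_vec p) m = (\<Sum>a\<in>keys p. if a = m then lookup p a else 0)"
    unfolding lin_ext_def lookup_sum
    by (rule sum.cong) (simp_all add: basis_vec_def lookup_single when_def)
  then show "lookup (lin_ext basis_vec p) m = lookup p m"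
    by (auto simp: in_keys_iff)
qed

text \<open>The universal property of a monoid algebra.\<close>

lemma lin_ext_multiplicative:
  fixes G :: "'a::comm_monoid_add \<Rightarrow> ('b::comm_monoid_add \<Rightarrow>\<^sub>0 'k::comm_ring_1)"
  assumes "\<And>a b. G (a + b) = G a * G b"
  shows "lin_ext G (p * q) = lin_ext G p * lin_ext G q"
proof -
  have "lin_ext G (Poly_Mapping.single a c * q) = lin_ext G (Poly_Mapping.single a c) * lin_ext G q"
    for a c
  proof -
    have "lin_ext G (Poly_Mapping.single a c * q) =
        lin_ext G (Poly_Mapping.single a c * lin_ext basis_vec q)"
      by (simp add: lin_ext_basis)
    also have "\<dots> = lin_ext (\<lambda>b. lin_ext G (Poly_Mapping.single a c * basis_vec b)) q"
      by (simp add: lin_ext_lin_ext flip: lin_ext_mult_left)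
    also have "\<dots> = lin_ext (\<lambda>b. lin_ext G (Poly_Mapping.single a c) * G b) q"
      by (simp add: basis_vec_def mult_single assms scale_mult_left)
    finally show ?thesis by (simp add: lin_ext_mult_left)
  qed
  then have *: "lin_ext G (basis_vec a * q) = G a * lin_ext G q" for a
    by (simp add: basis_vec_def)
  have "lin_ext G (p * q) = lin_ext G (lin_ext basis_vec p * q)"
    by (simp add: lin_ext_basis)
  also have "\<dots> = lin_ext (\<lambda>a. lin_ext G (basis_vec a * q)) p"
    by (simp add: lin_ext_lin_ext flip: lin_ext_mult_right)
  finally show ?thesis by (simp add: * lin_ext_mult_right)
qed

section \<open>Convolution and the multiplicativity of the antipode\<close>

text \<open>The factors are given by their values on the monomial basis, since the antipode itself is
  linear on the polynomials in the variables of \<open>X\<close> only.\<close>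

definition convolution ::
  "('k::comm_ring_1 pol \<Rightarrow> 'k pol2) \<Rightarrow> (monom \<Rightarrow> 'k pol) \<Rightarrow> (monom \<Rightarrow> 'k pol) \<Rightarrow> 'k pol \<Rightarrow> 'k pol"
  where "convolution \<Delta> f g p = lin_ext (\<lambda>(a, b). f a * g b) (\<Delta> p)"

text \<open>The two sides arise by applying \<open>a \<otimes> b \<otimes> c \<mapsto> f(a) g(b) h(c)\<close> to the two sides of the
  coassociativity equation.\<close>

lemma convolution_assoc:
  assumes "polynomial_bialgebra X \<Delta>" "p \<in> S_alg X"
  shows "convolution \<Delta> (\<lambda>a. convolution \<Delta> f g (basis_vec a)) h p =
         convolution \<Delta> f (\<lambda>b. convolution \<Delta> g h (basis_vec b)) p"
proof -
  let ?F = "\<lambda>(a, b, c). f a * g b * h c"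
  have "lin_ext ?F (tensor_assoc (tensor_map \<Delta> id t)) =
      lin_ext (\<lambda>(a, b). convolution \<Delta> f g (basis_vec a) * h b) t" for t
    by (simp add: tensor_assoc_def tensor_map_def lin_ext_lin_ext lin_ext_tensor convolution_def
      case_prod_unfold lin_ext_mult_right)
  moreover have "lin_ext ?F (tensor_map id \<Delta> t) =
      lin_ext (\<lambda>(a, b). f a * convolution \<Delta> g h (basis_vec b)) t" for t
    by (simp add: tensor_map_def lin_ext_lin_ext lin_ext_tensor convolution_def
      case_prod_unfold mult.assoc lin_ext_mult_left)
  moreover have "tensor_assoc (tensor_map \<Delta> id (\<Delta> p)) = tensor_map id \<Delta> (\<Delta> p)"
    using assms by (simp add: polynomial_bialgebra_def)
  ultimately show ?thesis unfolding convolution_def[of \<Delta> _ _ p] by metis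
qed

text \<open>By commutativity of the target, \<open>a \<otimes> b \<mapsto> f(a) g(b)\<close> is an algebra morphism when \<open>f\<close> and \<open>g\<close>
  are, and the coproduct is one.\<close>

lemma convolution_multiplicative:
  assumes "polynomial_bialgebra X \<Delta>" "p \<in> S_alg X" "q \<in> S_alg X"
    and "\<And>a b. f (a + b) = f a * f b" "\<And>a b. g (a + b) = g a * g b"
  shows "convolution \<Delta> f g (p * q) = convolution \<Delta> f g p * convolution \<Delta> f g q"
proof -
  have "\<Delta> (p * q) = \<Delta> p * \<Delta> q"
    using assms by (simp add: polynomial_bialgebra_def)
  then show ?thesis
    unfolding convolution_def
    by (simp add: lin_ext_multiplicative case_prod_unfold assms(4,5) mult_ac)
qed

text \<open>The algebra morphism with prescribed values on the generators, on the monomial basis.\<close>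

definition monom_hom :: "(nat \<Rightarrow> 'k::comm_ring_1 pol) \<Rightarrow> monom \<Rightarrow> 'k pol" where
  "monom_hom s m = (\<Prod>i\<in>keys m. s i ^ lookup m i)"

lemma monom_hom_superset:
  assumes "finite A" "keys m \<subseteq> A"
  shows "monom_hom s m = (\<Prod>i\<in>A. s i ^ lookup m i)"
  unfolding monom_hom_def using assms
  by (intro prod.mono_neutral_left) (auto simp: in_keys_iff)

lemma monom_hom_zero [simp]: "monom_hom s 0 = 1"
  by (simp add: monom_hom_def)

lemma monom_hom_single [simp]: "monom_hom s (Poly_Mapping.single i (Suc 0)) = s i"
  by (simp add: monom_hom_def)

lemma monom_hom_add: "monom_hom s (a + b) = monom_hom s a * monom_hom s b"
  using keys_add[of a b]
  by (simp add: monom_hom_superset[of "keys a \<union> keys b"] lookup_add power_add prod.distrib)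

lemma mset_monom_add [simp]:
  "mset_monom (add_mset i I) = Poly_Mapping.single i 1 + mset_monom I"
  by (simp add: mset_monom_def)

lemma mset_monom_empty [simp]: "mset_monom {#} = 0"
  by (simp add: mset_monom_def)

lemma monom_hom_mset_monom: "monom_hom s (mset_monom I) = (\<Prod>i\<in>#I. s i)"
  by (induction I) (simp_all add: monom_hom_add)

lemma lookup_mset_monom [simp]: "lookup (mset_monom I) i = count I i"
  by (induction I) (auto simp: lookup_add lookup_single when_def)

lemma keys_mset_monom [simp]: "keys (mset_monom I) = set_mset I"
  by (auto simp: in_keys_iff)

lemma inj_mset_monom: "inj mset_monom"
  by (metis injI lookup_mset_monom multiset_eqI)

lemma mset_monom_cases:
  obtains I where "m = mset_monom I"
proof
  have "finite {i. lookup m i > 0}" by simp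
  then show "m = mset_monom (Abs_multiset (lookup m))"
    by (intro poly_mapping_eqI) (simp add: count_Abs_multiset)
qed

lemma basis_vec_in_S_alg: "basis_vec m \<in> S_alg X \<longleftrightarrow> m \<in> monoms X" for m :: monom
  by (auto simp: S_alg_def basis_vec_def)

lemma single_one_nonzero [simp]: "Poly_Mapping.single i (Suc 0) \<noteq> 0"
  by (metis lookup_single_eq lookup_zero nat.distinct(1))

lemma counit_basis_vec: "counit (basis_vec m) = (if m = 0 then 1 else 0)"
  by (simp add: counit_def basis_vec_def lookup_single when_def)

lemma basis_vec_single_one: "basis_vec (Poly_Mapping.single i (Suc 0)) = gen i"
  by (simp add: gen_def)

lemma counit_gen [simp]: "counit (gen i) = 0"
  by (simp add: gen_def counit_basis_vec)

lemma gen_in_S_alg: "i \<in> X \<Longrightarrow> gen i \<in> S_alg X"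
  by (simp add: gen_def basis_vec_in_S_alg monoms_def)

lemma basis_vec_zero: "basis_vec 0 = (1 :: 'k::comm_ring_1 pol)"
  by (simp add: basis_vec_def flip: single_one)

lemma basis_vec_add: "basis_vec (a + b) = basis_vec a * (basis_vec b :: 'k::comm_ring_1 pol)"
  by (simp add: basis_vec_def mult_single)

lemma coproduct_gen:
  "\<Delta> (gen i) = red_coprod \<Delta> (gen i)
     + basis_vec (Poly_Mapping.single i 1, 0) + basis_vec (0, Poly_Mapping.single i 1)"
  by (simp add: red_coprod_def gen_def tensor_basis_vec flip: basis_vec_zero)

text \<open>Right-handedness makes the left factor a generator. The right factor is never constant: the
  terms \<open>a \<otimes> 1\<close> are seen by the counit axiom, which leaves only \<open>b\<^sub>i \<otimes> 1\<close> in the full coproduct.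
  Hence the structure coefficients with empty \<open>I\<close> vanish.\<close>

lemma keys_red_coprod_gen:
  fixes \<Delta> :: "'k::comm_ring_1 pol \<Rightarrow> 'k pol2"
  assumes "polynomial_bialgebra X \<Delta>" "right_handed X \<Delta>" "i \<in> X"
  shows "keys (red_coprod \<Delta> (gen i)) \<subseteq> gen_monoms X \<times> (monoms X - {0})"
proof -
  let ?r = "red_coprod \<Delta> (gen i)"
    and ?G = "\<lambda>(a, b). scale (counit (basis_vec b)) (basis_vec a) :: 'k pol"
  have "(gen i :: 'k pol) \<in> V_space X"
    using \<open>i \<in> X\<close> by (auto simp: V_space_def gen_def basis_vec_def gen_monoms_def)
  then have "?r \<in> V_tensor_S X" using assms(2) by (simp add: right_handed_def)
  moreover have "lookup ?r (a, 0) = 0" for a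
  proof -
    \<comment> \<open>Applying the counit to the right factor extracts the terms \<open>a \<otimes> 1\<close>.\<close>
    have "lin_ext ?G (\<Delta> (gen i)) = gen i"
      using assms(1,3) by (simp add: polynomial_bialgebra_def gen_in_S_alg)
    then have "lin_ext ?G ?r = 0"
      by (subst (asm) coproduct_gen) (simp add: lin_ext_add counit_basis_vec basis_vec_single_one)
    then have "0 = lookup (lin_ext ?G ?r) a" by simp
    also have "\<dots> = (\<Sum>x\<in>keys ?r. if x = (a, 0) then lookup ?r x else 0)"
      unfolding lin_ext_def lookup_sum
      by (rule sum.cong) (auto simp: basis_vec_def lookup_single when_def counit_def split: if_splits)
    also have "\<dots> = lookup ?r (a, 0)"
      by (auto simp: in_keys_iff)
    finally show ?thesis ..
  qed
  ultimately show ?thesis by (auto simp: V_tensor_S_def in_keys_iff)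
qed

lemma coproduct_key_monoms:
  assumes "polynomial_bialgebra X \<Delta>" "p \<in> S_alg X" "(a, b) \<in> keys (\<Delta> p)"
  shows "a \<in> monoms X" "b \<in> monoms X"
proof -
  have "\<Delta> p \<in> S_tensor_S X"
    using assms(1,2) by (simp add: polynomial_bialgebra_def linear_between_def)
  with assms(3) show "a \<in> monoms X" "b \<in> monoms X" by (auto simp: S_tensor_S_def)
qed

lemma antipode_one:
  assumes "polynomial_hopf_algebra X \<Delta> S"
  shows "S 1 = 1"
proof -
  have D: "\<Delta> 1 = 1" and
    "\<forall>p\<in>S_alg X. lin_ext (\<lambda>(a, b). S (basis_vec a) * basis_vec b) (\<Delta> p) = scale (counit p) 1"
    using assms
    by (simp_all add: polynomial_hopf_algebra_def polynomial_bialgebra_def is_antipode_def)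
  moreover have "1 \<in> S_alg X" by (simp add: S_alg_def monoms_def)
  ultimately have
    "lin_ext (\<lambda>(a, b). S (basis_vec a) * basis_vec b) 1 = scale (counit 1) 1"
    by metis
  then show ?thesis
    by (simp add: counit_def lin_ext_def flip: single_one)
      (simp add: zero_prod_def basis_vec_zero)
qed

text \<open>The algebra morphism \<open>?S'\<close> that extends the values of \<open>S\<close> on generators is a left
  convolution inverse of the identity; as \<open>S\<close> is a right inverse, they coincide. The left inverse
  property needs checking on generators only; \<open>S\<close> has it, and the left factors of the coproduct of
  a generator are generators or \<open>1\<close>, on which \<open>S\<close> and \<open>?S'\<close> agree.\<close>

theorem antipode_monomial:
  fixes S :: "'k::comm_ring_1 pol \<Rightarrow> 'k pol"
  assumes hopf: "polynomial_hopf_algebra X \<Delta> S" and rh: "right_handed X \<Delta>"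
    and m: "m \<in> monoms X"
  shows "S (basis_vec m) = monom_hom (\<lambda>i. S (gen i)) m"
proof -
  let ?S = "\<lambda>m. S (basis_vec m)" and ?S' = "monom_hom (\<lambda>i. S (gen i))"
  have bi: "polynomial_bialgebra X \<Delta>" and ap: "is_antipode X \<Delta> S"
    using hopf by (simp_all add: polynomial_hopf_algebra_def)
  have left: "convolution \<Delta> ?S basis_vec p = scale (counit p) 1"
    and right: "convolution \<Delta> basis_vec ?S p = scale (counit p) 1" if "p \<in> S_alg X" for p
    using ap that by (simp_all add: is_antipode_def convolution_def)
  have unit: "convolution \<Delta> ?S' basis_vec 1 = 1"
  proof -
    have "\<Delta> 1 = basis_vec (0, 0)"
      using bi by (simp add: polynomial_bialgebra_def basis_vec_def flip: zero_prod_def)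
    then show ?thesis by (simp add: convolution_def basis_vec_zero)
  qed
  have kill: "convolution \<Delta> ?S' basis_vec (gen i) = 0" if i: "i \<in> X" for i
  proof -
    have "convolution \<Delta> ?S' basis_vec (gen i) = convolution \<Delta> ?S basis_vec (gen i)"
      unfolding convolution_def
    proof (rule lin_ext_cong, clarify)
      fix a b assume "(a, b) \<in> keys (\<Delta> (gen i))"
      then have "(a, b) \<in> keys (red_coprod \<Delta> (gen i)) \<or> a = 0 \<or> a = Poly_Mapping.single i 1"
        by (subst (asm) coproduct_gen) (auto simp: in_keys_iff lookup_add basis_vec_def
          lookup_single when_def split: if_splits)
      then have "a = 0 \<or> a \<in> gen_monoms X"
        using keys_red_coprod_gen[OF bi rh i] i by (auto simp: gen_monoms_def)
      then show "?S' a * basis_vec b = ?S a * basis_vec b"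
        using antipode_one[OF hopf] by (auto simp: basis_vec_zero gen_monoms_def gen_def)
    qed
    also have "\<dots> = 0"
      by (simp add: left gen_in_S_alg i)
    finally show ?thesis .
  qed
  have left': "convolution \<Delta> ?S' basis_vec (basis_vec a) = scale (counit (basis_vec a)) 1"
    if "a \<in> monoms X" for a
  proof -
    obtain I where I: "a = mset_monom I" by (rule mset_monom_cases)
    show ?thesis
    proof (cases I)
      case empty
      then show ?thesis using unit by (simp add: I basis_vec_zero counit_def)
    next
      case (add i J)
      have i: "i \<in> X" and J: "mset_monom J \<in> monoms X"
        using that by (auto simp: I add monoms_def simp del: mset_monom_add)
      have "basis_vec a = gen i * (basis_vec (mset_monom J) :: 'k pol)"
        by (simp add: I add basis_vec_add gen_def)
      then have "convolution \<Delta> ?S' basis_vec (basis_vec a) = 0"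
        using convolution_multiplicative[OF bi, of "gen i" "basis_vec (mset_monom J)" ?S' basis_vec]
          i J kill[OF i]
        by (simp add: gen_in_S_alg basis_vec_in_S_alg monom_hom_add basis_vec_add)
      moreover have "a \<noteq> 0"
        by (metis I add keys_mset_monom keys_zero set_mset_eq_empty_iff add_mset_not_empty)
      ultimately show ?thesis by (simp add: counit_basis_vec)
    qed
  qed
  have counit_left: "lin_ext (\<lambda>(a, b). scale (counit (basis_vec a)) (basis_vec b)) (\<Delta> p) = p"
    and counit_right: "lin_ext (\<lambda>(a, b). scale (counit (basis_vec b)) (basis_vec a)) (\<Delta> p) = p"
    if "p \<in> S_alg X" for p
    using bi that by (simp_all add: polynomial_bialgebra_def)
  let ?p = "basis_vec m :: 'k pol"
  have p: "?p \<in> S_alg X" using m by (simp add: basis_vec_in_S_alg)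
  have "?S m = lin_ext ?S ?p" by simp
  also have "\<dots> = lin_ext ?S (lin_ext (\<lambda>(a, b). scale (counit (basis_vec a)) (basis_vec b)) (\<Delta> ?p))"
    using counit_left[OF p] by simp
  also have "\<dots> = lin_ext (\<lambda>(a, b). scale (counit (basis_vec a)) 1 * ?S b) (\<Delta> ?p)"
    by (simp add: lin_ext_lin_ext case_prod_unfold lin_ext_scale scale_mult_left)
  also have "\<dots> = convolution \<Delta> (\<lambda>a. convolution \<Delta> ?S' basis_vec (basis_vec a)) ?S ?p"
    unfolding convolution_def[of \<Delta> _ ?S]
    by (rule lin_ext_cong) (auto simp: left' coproduct_key_monoms[OF bi p])
  also have "\<dots> = convolution \<Delta> ?S' (\<lambda>b. convolution \<Delta> basis_vec ?S (basis_vec b)) ?p"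
    by (rule convolution_assoc[OF bi p])
  also have "\<dots> = lin_ext (\<lambda>(a, b). ?S' a * scale (counit (basis_vec b)) 1) (\<Delta> ?p)"
    unfolding convolution_def[of \<Delta> ?S']
    by (rule lin_ext_cong)
      (auto simp: right basis_vec_in_S_alg coproduct_key_monoms[OF bi p])
  also have "\<dots> = lin_ext ?S' (lin_ext (\<lambda>(a, b). scale (counit (basis_vec b)) (basis_vec a)) (\<Delta> ?p))"
    by (simp add: lin_ext_lin_ext case_prod_unfold lin_ext_scale scale_mult_right)
  also have "\<dots> = ?S' m" using counit_right[OF p] by simp
  finally show ?thesis .
qed


section \<open>The recursion for the antipode on generators\<close>

lemma right_handed_key_cases:
  assumes "polynomial_bialgebra X \<Delta>" "right_handed X \<Delta>" "i \<in> X"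
    and "x \<in> keys (red_coprod \<Delta> (gen i))"
  obtains i0 I where "x = (mset_monom {#i0#}, mset_monom I)" "i0 \<in> X" "set_mset I \<subseteq> X" "I \<noteq> {#}"
proof -
  obtain a b where x: "x = (a, b)" by fastforce
  obtain I where I: "b = mset_monom I" by (rule mset_monom_cases)
  have "a \<in> gen_monoms X" "b \<in> monoms X" "b \<noteq> 0"
    using keys_red_coprod_gen[OF assms(1-3)] assms(4) x by auto
  then obtain i0 where "a = mset_monom {#i0#}" "i0 \<in> X" "set_mset I \<subseteq> X" "I \<noteq> {#}"
    using I that by (clarsimp simp: gen_monoms_def monoms_def) force
  then show thesis using that x I by blast
qed

text \<open>The decorations \<open>i0\<close> of a root and the multisets \<open>I\<close> of branches that can occur below index
  \<open>i\<close> in a tree with nonzero coefficient. By right-handedness they exhaust the reduced coproduct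
  of \<open>b\<^sub>i\<close>, and so there are finitely many.\<close>

definition branchings :: "('k::comm_ring_1 pol \<Rightarrow> 'k pol2) \<Rightarrow> nat \<Rightarrow> (nat \<times> nat multiset) set" where
  "branchings \<Delta> i = {(i0, I). struct_coeff \<Delta> i i0 I \<noteq> 0}"

lemma inj_branching: "inj (\<lambda>(i0, I). (mset_monom {#i0#}, mset_monom I))"
  by (auto simp: inj_def simp del: mset_monom_add dest!: injD[OF inj_mset_monom])

lemma image_branchings:
  assumes "polynomial_bialgebra X \<Delta>" "right_handed X \<Delta>" "i \<in> X"
  shows "(\<lambda>(i0, I). (mset_monom {#i0#}, mset_monom I)) ` branchings \<Delta> i =
         keys (red_coprod \<Delta> (gen i))" (is "?\<beta> ` _ = ?K")
proof
  show "?\<beta> ` branchings \<Delta> i \<subseteq> ?K"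
    by (auto simp: branchings_def struct_coeff_def in_keys_iff)
  show "?K \<subseteq> ?\<beta> ` branchings \<Delta> i"
  proof
    fix x assume x: "x \<in> ?K"
    with assms obtain i0 I where "x = (mset_monom {#i0#}, mset_monom I)"
      by (rule right_handed_key_cases)
    with x show "x \<in> ?\<beta> ` branchings \<Delta> i"
      by (force simp: branchings_def struct_coeff_def in_keys_iff)
  qed
qed

lemma finite_branchings:
  assumes "polynomial_bialgebra X \<Delta>" "right_handed X \<Delta>" "i \<in> X"
  shows "finite (branchings \<Delta> i)"
  by (rule finite_imageD[OF _ inj_on_subset[OF inj_branching subset_UNIV]])
    (simp only: image_branchings[OF assms] finite_keys)

lemma branchings_in:
  assumes "polynomial_bialgebra X \<Delta>" "right_handed X \<Delta>" "i \<in> X" "(i0, I) \<in> branchings \<Delta> i"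
  shows "i0 \<in> X" "set_mset I \<subseteq> X" "I \<noteq> {#}"
proof -
  have "(mset_monom {#i0#}, mset_monom I) \<in> keys (red_coprod \<Delta> (gen i))"
    using assms(4) by (simp add: branchings_def struct_coeff_def in_keys_iff del: mset_monom_add)
  with assms(1-3) obtain j J where
    eq: "(mset_monom {#i0#}, mset_monom I) = (mset_monom {#j#}, mset_monom J)"
    and "j \<in> X" "set_mset J \<subseteq> X" "J \<noteq> {#}"
    by (rule right_handed_key_cases)
  moreover have "(i0, I) = (j, J)"
    using inj_branching by (rule injD) (use eq in simp)
  ultimately show "i0 \<in> X" "set_mset I \<subseteq> X" "I \<noteq> {#}" by simp_all
qed

text \<open>The equation \<open>id * S = \<eta>\<epsilon>\<close> at \<open>b\<^sub>i\<close>: the terms \<open>b\<^sub>i \<otimes> 1\<close> and \<open>1 \<otimes> b\<^sub>i\<close> of the coproduct give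
  \<open>b\<^sub>i\<close> and \<open>S(b\<^sub>i)\<close>, and \<open>antipode_monomial\<close> splits \<open>S(b\<^sub>I)\<close>.\<close>

theorem antipode_gen:
  fixes S :: "'k::comm_ring_1 pol \<Rightarrow> 'k pol"
  assumes hopf: "polynomial_hopf_algebra X \<Delta> S" and rh: "right_handed X \<Delta>" and i: "i \<in> X"
  shows "S (gen i) = - gen i
    - (\<Sum>(i0, I)\<in>branchings \<Delta> i. scale (struct_coeff \<Delta> i i0 I) (gen i0 * (\<Prod>k\<in>#I. S (gen k))))"
proof -
  have bi: "polynomial_bialgebra X \<Delta>" and ap: "is_antipode X \<Delta> S"
    using hopf by (simp_all add: polynomial_hopf_algebra_def)
  let ?F = "\<lambda>(a, b). basis_vec a * S (basis_vec b)" and ?r = "red_coprod \<Delta> (gen i)"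
  have "lin_ext ?F (\<Delta> (gen i)) = 0"
    using ap i by (simp add: is_antipode_def gen_in_S_alg)
  then have "lin_ext ?F ?r + gen i + S (gen i) = 0"
    by (subst (asm) coproduct_gen)
      (simp add: lin_ext_add basis_vec_zero antipode_one[OF hopf] basis_vec_single_one)
  moreover have "lin_ext ?F ?r =
    (\<Sum>(i0, I)\<in>branchings \<Delta> i. scale (struct_coeff \<Delta> i i0 I) (gen i0 * (\<Prod>k\<in>#I. S (gen k))))"
    unfolding lin_ext_def image_branchings[OF bi rh i, symmetric]
  proof (subst sum.reindex[OF inj_on_subset[OF inj_branching subset_UNIV]], rule sum.cong[OF refl],
      clarsimp simp del: mset_monom_add)
    fix i0 I assume I: "(i0, I) \<in> branchings \<Delta> i"
    have "S (basis_vec (mset_monom I)) = (\<Prod>k\<in>#I. S (gen k))"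
      using branchings_in[OF bi rh i I]
      by (simp add: antipode_monomial[OF hopf rh] monoms_def monom_hom_mset_monom)
    then show "scale (lookup ?r (mset_monom {#i0#}, mset_monom I))
        (basis_vec (mset_monom {#i0#}) * S (basis_vec (mset_monom I))) =
      scale (struct_coeff \<Delta> i i0 I) (gen i0 * (\<Prod>k\<in>#I. S (gen k)))"
      by (simp add: struct_coeff_def gen_def)
  qed
  ultimately show ?thesis by (simp add: algebra_simps eq_neg_iff_add_eq_0)
qed

section \<open>The degree filtration\<close>

definition monom_degree :: "monom \<Rightarrow> nat" where
  "monom_degree m = (\<Sum>i\<in>keys m. lookup m i)"

lemma monom_degree_superset:
  assumes "finite A" "keys m \<subseteq> A"
  shows "monom_degree m = (\<Sum>i\<in>A. lookup m i)"
  unfolding monom_degree_def using assms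
  by (intro sum.mono_neutral_left) (auto simp: in_keys_iff)

lemma monom_degree_add: "monom_degree (a + b) = monom_degree a + monom_degree b"
  using keys_add[of a b]
  by (simp add: monom_degree_superset[of "keys a \<union> keys b"] lookup_add sum.distrib)

lemma monom_degree_zero [simp]: "monom_degree 0 = 0"
  by (simp add: monom_degree_def)

lemma monom_degree_single [simp]: "monom_degree (Poly_Mapping.single i (Suc 0)) = 1"
  by (simp add: monom_degree_def)

text \<open>These polynomials form the powers of the augmentation ideal; congruence modulo them replaces
  comparison of truncated power series.\<close>

definition vanishes_below :: "nat \<Rightarrow> 'k::comm_ring_1 pol \<Rightarrow> bool" where
  "vanishes_below N p \<longleftrightarrow> (\<forall>m\<in>keys p. N \<le> monom_degree m)"

lemma vanishes_below_zero [simp]: "vanishes_below N 0"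
  by (simp add: vanishes_below_def)

lemma vanishes_below_0 [simp]: "vanishes_below 0 p"
  by (simp add: vanishes_below_def)

lemma vanishes_below_add: "vanishes_below N p \<Longrightarrow> vanishes_below N q \<Longrightarrow> vanishes_below N (p + q)"
  using keys_add[of p q] by (auto simp: vanishes_below_def)

lemma vanishes_below_uminus: "vanishes_below N p \<Longrightarrow> vanishes_below N (- p)"
  by (simp add: vanishes_below_def in_keys_iff)

lemma vanishes_below_scale: "vanishes_below N p \<Longrightarrow> vanishes_below N (scale c p)"
  using keys_scale[of c p] by (auto simp: vanishes_below_def)

lemma vanishes_below_sum:
  "(\<And>a. a \<in> A \<Longrightarrow> vanishes_below N (f a)) \<Longrightarrow> vanishes_below N (\<Sum>a\<in>A. f a)"
  by (induction A rule: infinite_finite_induct) (auto intro: vanishes_below_add)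

lemma vanishes_below_mult:
  assumes "vanishes_below M p" "vanishes_below N q"
  shows "vanishes_below (M + N) (p * q)"
  using assms keys_mult[of p q]
  by (fastforce simp: vanishes_below_def monom_degree_add intro: add_mono)

lemma vanishes_below_gen: "vanishes_below 1 (gen i)"
  by (simp add: vanishes_below_def gen_def basis_vec_def)

text \<open>A product of congruent factors is congruent: replace the factors one at a time.\<close>

lemma vanishes_below_prod_diff:
  assumes "\<And>k. k \<in># I \<Longrightarrow> vanishes_below N (f k - g k)"
  shows "vanishes_below N ((\<Prod>k\<in>#I. f k) - (\<Prod>k\<in>#I. g k))"
  using assms
proof (induction I)
  case (add j I)
  have "(\<Prod>k\<in>#add_mset j I. f k) - (\<Prod>k\<in>#add_mset j I. g k) =
      (f j - g j) * (\<Prod>k\<in>#I. f k) + g j * ((\<Prod>k\<in>#I. f k) - (\<Prod>k\<in>#I. g k))"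
    by (simp add: algebra_simps)
  moreover have "vanishes_below N ((f j - g j) * (\<Prod>k\<in>#I. f k))"
    using vanishes_below_mult[of N "f j - g j" 0] add.prems by simp
  moreover have "vanishes_below N (g j * ((\<Prod>k\<in>#I. f k) - (\<Prod>k\<in>#I. g k)))"
    using vanishes_below_mult[of 0 "g j" N] add by simp
  ultimately show ?case by (simp only: vanishes_below_add)
qed simp

section \<open>Trees of bounded height\<close>

abbreviation (input) tree_term :: "('k::comm_ring_1 pol \<Rightarrow> 'k pol2) \<Rightarrow> dtree \<Rightarrow> 'k pol" where
  "tree_term \<Delta> T \<equiv> scale ((-1) ^ tree_length T * tree_coeff \<Delta> T) (b_value T)"

lemma tree_term_Node:
  "tree_term \<Delta> (Node i i0 Ts) =
   - scale (struct_coeff \<Delta> i i0 (mset (map root_index Ts)))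
       (gen i0 * prod_list (map (tree_term \<Delta>) Ts))"
proof -
  have "prod_list (map (tree_term \<Delta>) Ts) =
      scale ((-1) ^ sum_list (map tree_length Ts) * prod_list (map (tree_coeff \<Delta>) Ts))
        (prod_list (map b_value Ts))"
    by (induction Ts) (simp_all add: scale_mult_left scale_mult_right scale_scale power_add mult_ac)
  then show ?thesis
    by (simp add: scale_mult_right scale_scale scale_minus mult_ac)
qed

text \<open>Each vertex contributes one variable to the \<open>b\<close>-value. So a monomial determines the number of
  vertices of the trees that contribute to it.\<close>

lemma b_value_monomial:
  "\<exists>m. b_value T = (basis_vec m :: 'k::comm_ring_1 pol) \<and> monom_degree m = tree_length T"
proof (induction T)
  case (Leaf i)
  show ?case by (auto simp: gen_def)
next
  case (Node i i0 Ts)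
  have "\<exists>m. prod_list (map b_value Ts) = (basis_vec m :: 'k pol) \<and>
      monom_degree m = sum_list (map tree_length Ts)"
    using Node.IH
  proof (induction Ts)
    case Nil
    show ?case by (intro exI[of _ 0]) (simp add: basis_vec_zero)
  next
    case (Cons T Ts)
    obtain m where "b_value T = (basis_vec m :: 'k pol)" "monom_degree m = tree_length T"
      using Cons.prems[of T] by auto
    moreover obtain m' where "prod_list (map b_value Ts) = (basis_vec m' :: 'k pol)"
      "monom_degree m' = sum_list (map tree_length Ts)"
      using Cons by auto
    ultimately show ?case
      by (intro exI[of _ "m + m'"]) (simp add: basis_vec_add monom_degree_add)
  qed
  then obtain m where "prod_list (map b_value Ts) = (basis_vec m :: 'k pol)"
    "monom_degree m = sum_list (map tree_length Ts)"
    by blast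
  then show ?case
    by (intro exI[of _ "Poly_Mapping.single i0 1 + m"])
      (simp add: gen_def basis_vec_add monom_degree_add)
qed

lemma lookup_tree_term_nonzero:
  assumes "lookup (tree_term \<Delta> T) m \<noteq> 0"
  shows "tree_coeff \<Delta> T \<noteq> 0" "tree_length T = monom_degree m"
proof -
  obtain m' where "b_value T = (basis_vec m' :: 'a pol)" "monom_degree m' = tree_length T"
    using b_value_monomial by blast
  with assms show "tree_coeff \<Delta> T \<noteq> 0" "tree_length T = monom_degree m"
    by (auto simp: basis_vec_def lookup_single when_def split: if_splits)
qed

lemma set_Cons_eq_image: "set_Cons A B = (\<lambda>(x, xs). x # xs) ` (A \<times> B)"
  by (auto simp: set_Cons_def)

lemma finite_listset:
  "(\<And>A. A \<in> set As \<Longrightarrow> finite A) \<Longrightarrow> finite (listset As)"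
  by (induction As) (auto simp: set_Cons_eq_image)

lemma in_listset_iff: "xs \<in> listset As \<longleftrightarrow> list_all2 (\<in>) xs As"
  by (induction As arbitrary: xs) (auto simp: set_Cons_def list_all2_Cons2)

text \<open>Generalised distributivity, for the choice of one branch per occurrence of an index.\<close>

lemma sum_listset:
  fixes f :: "'a \<Rightarrow> 'b::comm_semiring_1"
  shows "(\<Sum>xs\<in>listset As. prod_list (map f xs)) = prod_list (map (sum f) As)"
proof (induction As)
  case (Cons A As)
  have "(\<Sum>xs\<in>listset (A # As). prod_list (map f xs)) =
      (\<Sum>(x, xs)\<in>A \<times> listset As. f x * prod_list (map f xs))"
    by (auto simp: set_Cons_eq_image sum.reindex inj_on_def case_prod_unfold)
  also have "\<dots> = (\<Sum>x\<in>A. f x) * (\<Sum>xs\<in>listset As. prod_list (map f xs))"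
    by (simp add: sum_product sum.cartesian_product)
  finally show ?case using Cons.IH by simp
qed simp

text \<open>The trees of height at most \<open>h\<close> (a leaf has height one) with root index \<open>i\<close>, all of whose
  branchings have a nonzero structure coefficient. Restricting to these branchings keeps
  the set finite when \<open>X\<close> is infinite. Listing \<open>I\<close> in increasing order matches the
  representation of non planar trees by lists with sorted root indices.\<close>

primrec trees_upto :: "('k::comm_ring_1 pol \<Rightarrow> 'k pol2) \<Rightarrow> nat \<Rightarrow> nat \<Rightarrow> dtree set" where
  "trees_upto \<Delta> 0 = (\<lambda>i. {})"
| "trees_upto \<Delta> (Suc h) = (\<lambda>i. insert (Leaf i)
     (\<Union>(i0, I)\<in>branchings \<Delta> i.
        Node i i0 ` listset (map (trees_upto \<Delta> h) (sorted_list_of_multiset I))))"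

lemma root_index_trees_upto: "T \<in> trees_upto \<Delta> h i \<Longrightarrow> root_index T = i"
  by (cases h) auto

lemma root_indices_listset:
  assumes "Ts \<in> listset (map (trees_upto \<Delta> h) ks)"
  shows "map root_index Ts = ks"
proof (rule nth_equalityI)
  show "length (map root_index Ts) = length ks"
    using assms by (simp add: in_listset_iff list_all2_conv_all_nth)
  show "map root_index Ts ! j = ks ! j" if "j < length (map root_index Ts)" for j
    using assms that by (auto simp: in_listset_iff list_all2_conv_all_nth intro!: root_index_trees_upto)
qed

context
  fixes X :: "nat set" and \<Delta> :: "'k::comm_ring_1 pol \<Rightarrow> 'k pol2"
  assumes bi: "polynomial_bialgebra X \<Delta>" and rh: "right_handed X \<Delta>"
begin

lemma finite_trees_upto: "i \<in> X \<Longrightarrow> finite (trees_upto \<Delta> h i)"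
proof (induction h arbitrary: i)
  case (Suc h)
  have "finite (listset (map (trees_upto \<Delta> h) (sorted_list_of_multiset I)))"
    if "(i0, I) \<in> branchings \<Delta> i" for i0 I
  proof -
    have "finite (trees_upto \<Delta> h k)" if "k \<in># I" for k
      using branchings_in(2)[OF bi rh Suc.prems \<open>(i0, I) \<in> _\<close>] that Suc.IH by blast
    then show ?thesis by (auto intro!: finite_listset)
  qed
  then show ?case using finite_branchings[OF bi rh Suc.prems] by auto
qed simp

lemma trees_upto_subset: "i \<in> X \<Longrightarrow> trees_upto \<Delta> h i \<subseteq> trees_of X i"
proof (induction h arbitrary: i)
  case (Suc h)
  have "Node i i0 Ts \<in> trees_of X i"
    if I: "(i0, I) \<in> branchings \<Delta> i"
      and Ts: "Ts \<in> listset (map (trees_upto \<Delta> h) (sorted_list_of_multiset I))" for i0 I Ts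
  proof -
    have ks: "map root_index Ts = sorted_list_of_multiset I"
      using Ts by (rule root_indices_listset)
    moreover have "decorated_tree X T" if T: "T \<in> set Ts" for T
    proof -
      obtain k where "k \<in># I" "T \<in> trees_upto \<Delta> h k"
        using Ts T by (force simp: in_listset_iff list_all2_conv_all_nth in_set_conv_nth
          simp flip: set_sorted_list_of_multiset)
      then show ?thesis
        using Suc.IH branchings_in(2)[OF bi rh Suc.prems I] by (auto simp: trees_of_def)
    qed
    moreover have "Ts \<noteq> []"
      using ks branchings_in(3)[OF bi rh Suc.prems I]
      by (metis list.map_disc_iff mset.simps(1) mset_sorted_list_of_multiset)
    ultimately show ?thesis
      using branchings_in(1)[OF bi rh Suc.prems I] Suc.prems by (simp add: trees_of_def)
  qed
  then show ?case using Suc.prems by (auto simp: trees_of_def)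
qed simp

text \<open>The partial sums satisfy the recursion \<open>antipode_gen\<close> with the height bound dropping by one:
  split off the root, and distribute the product of the sums over the branches. A tree determines
  its root branching, since the indices of its branches are those of \<open>I\<close>; hence no tree is
  counted twice.\<close>

lemma sum_trees_upto_Suc:
  assumes i: "i \<in> X"
  shows "(\<Sum>T\<in>trees_upto \<Delta> (Suc h) i. tree_term \<Delta> T) = - gen i
    - (\<Sum>(i0, I)\<in>branchings \<Delta> i. scale (struct_coeff \<Delta> i i0 I)
         (gen i0 * (\<Prod>k\<in>#I. \<Sum>T\<in>trees_upto \<Delta> h k. tree_term \<Delta> T)))"
proof -
  let ?L = "\<lambda>I. listset (map (trees_upto \<Delta> h) (sorted_list_of_multiset I))"
  let ?N = "\<lambda>(i0, I). Node i i0 ` ?L I"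
  have fin: "finite (?L I)" if "(i0, I) \<in> branchings \<Delta> i" for i0 I
  proof -
    have "finite (trees_upto \<Delta> h k)" if "k \<in># I" for k
      using branchings_in(2)[OF bi rh i \<open>(i0, I) \<in> _\<close>] that finite_trees_upto by blast
    then show ?thesis by (auto intro!: finite_listset)
  qed
  have disjoint: "?N x \<inter> ?N y = {}" if "x \<noteq> y" for x y
  proof (rule ccontr)
    obtain i0 I j0 J where xy: "x = (i0, I)" "y = (j0, J)" by (metis surj_pair)
    assume "?N x \<inter> ?N y \<noteq> {}"
    then obtain Ts where "i0 = j0" and Ts: "Ts \<in> ?L I" "Ts \<in> ?L J"
      unfolding xy by blast
    from Ts have "sorted_list_of_multiset I = sorted_list_of_multiset J"
      using root_indices_listset by metis
    then have "I = J" by (metis mset_sorted_list_of_multiset)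
    with \<open>i0 = j0\<close> that xy show False by simp
  qed
  have inner: "(\<Sum>T\<in>?N (i0, I). tree_term \<Delta> T) = - scale (struct_coeff \<Delta> i i0 I)
      (gen i0 * (\<Prod>k\<in>#I. \<Sum>T\<in>trees_upto \<Delta> h k. tree_term \<Delta> T))" for i0 I
  proof -
    have "(\<Sum>T\<in>?N (i0, I). tree_term \<Delta> T) = (\<Sum>Ts\<in>?L I. tree_term \<Delta> (Node i i0 Ts))"
      by (simp add: sum.reindex inj_on_def)
    also have "\<dots> = (\<Sum>Ts\<in>?L I.
        - scale (struct_coeff \<Delta> i i0 I) (gen i0 * prod_list (map (tree_term \<Delta>) Ts)))"
      unfolding tree_term_Node
      by (intro sum.cong refl) (simp add: root_indices_listset)
    also have "\<dots> = - scale (struct_coeff \<Delta> i i0 I)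
        (gen i0 * (\<Sum>Ts\<in>?L I. prod_list (map (tree_term \<Delta>) Ts)))"
      by (simp add: sum_negf scale_sum sum_distrib_left)
    also have "(\<Sum>Ts\<in>?L I. prod_list (map (tree_term \<Delta>) Ts)) =
        (\<Prod>k\<in>#I. \<Sum>T\<in>trees_upto \<Delta> h k. tree_term \<Delta> T)"
      unfolding sum_listset
      by (simp add: comp_def flip: prod_mset_prod_list mset_map)
        (simp only: mset_map mset_sorted_list_of_multiset)
    finally show ?thesis .
  qed
  have finN: "finite (?N x)" if "x \<in> branchings \<Delta> i" for x
    using fin[of "fst x" "snd x"] that by (simp add: case_prod_unfold)
  let ?U = "\<Union>x\<in>branchings \<Delta> i. ?N x"
  have "finite ?U" "Leaf i \<notin> ?U"
    using finN finite_branchings[OF bi rh i] by auto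
  moreover have "trees_upto \<Delta> (Suc h) i = insert (Leaf i) ?U" by simp
  ultimately have "(\<Sum>T\<in>trees_upto \<Delta> (Suc h) i. tree_term \<Delta> T) =
      tree_term \<Delta> (Leaf i) + (\<Sum>T\<in>?U. tree_term \<Delta> T)"
    by (simp only: sum.insert not_False_eq_True)
  also have "(\<Sum>T\<in>?U. tree_term \<Delta> T) = (\<Sum>x\<in>branchings \<Delta> i. \<Sum>T\<in>?N x. tree_term \<Delta> T)"
    by (intro sum.UNION_disjoint ballI impI finite_branchings[OF bi rh i] finN disjoint)
  finally show ?thesis
    using inner by (simp add: case_prod_unfold sum_negf scale_minus)
qed

end

text \<open>The number of vertices bounds the height, and a nonzero product has nonzero factors.\<close>

lemma in_trees_upto:
  fixes \<Delta> :: "'k::idom pol \<Rightarrow> 'k pol2"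
  assumes "decorated_tree X T" "tree_coeff \<Delta> T \<noteq> 0" "tree_length T \<le> h"
  shows "T \<in> trees_upto \<Delta> h (root_index T)"
  using assms
proof (induction T arbitrary: h)
  case (Leaf i)
  then show ?case by (cases h) auto
next
  case (Node i i0 Ts)
  then obtain h' where h: "h = Suc h'" by (cases h) auto
  have *: "T \<in> trees_upto \<Delta> h' (root_index T)" if T: "T \<in> set Ts" for T
  proof (rule Node.IH[OF T])
    show "decorated_tree X T" "tree_coeff \<Delta> T \<noteq> 0"
      using Node.prems T by (auto simp: prod_list_zero_iff)
    show "tree_length T \<le> h'"
      using Node.prems(3) member_le_sum_list[of "tree_length T" "map tree_length Ts"] T h by simp
  qed
  let ?I = "mset (map root_index Ts)"
  have "sorted_list_of_multiset ?I = map root_index Ts"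
    using Node.prems(1) by (simp add: sorted_sort_id flip: mset_map)
  with * have "Ts \<in> listset (map (trees_upto \<Delta> h') (sorted_list_of_multiset ?I))"
    by (simp add: in_listset_iff list_all2_conv_all_nth)
  moreover have "(i0, ?I) \<in> branchings \<Delta> i"
    using Node.prems(2) by (simp add: branchings_def)
  ultimately have "Node i i0 Ts \<in> (\<Union>(i0, I)\<in>branchings \<Delta> i.
      Node i i0 ` listset (map (trees_upto \<Delta> h') (sorted_list_of_multiset I)))"
    by (intro UN_I[of "(i0, ?I)"]) (simp_all only: prod.case imageI)
  then show ?case unfolding h by simp
qed

text \<open>The antipode and the partial sums satisfy the same recursion, in which the factor \<open>b\<^bsub>i\<^sub>0\<^esub>\<close>
  raises the degree by one; each unfolding therefore gains one degree of precision.\<close>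

lemma antipode_agrees_with_trees_upto:
  fixes S :: "'k::comm_ring_1 pol \<Rightarrow> 'k pol"
  assumes hopf: "polynomial_hopf_algebra X \<Delta> S" and rh: "right_handed X \<Delta>" and i: "i \<in> X"
  shows "vanishes_below h (S (gen i) - (\<Sum>T\<in>trees_upto \<Delta> h i. tree_term \<Delta> T))"
  using i
proof (induction h arbitrary: i)
  case (Suc h)
  have bi: "polynomial_bialgebra X \<Delta>"
    using hopf by (simp add: polynomial_hopf_algebra_def)
  let ?A = "\<lambda>k. \<Sum>T\<in>trees_upto \<Delta> h k. tree_term \<Delta> T"
  have "S (gen i) - (\<Sum>T\<in>trees_upto \<Delta> (Suc h) i. tree_term \<Delta> T) =
    - (\<Sum>(i0, I)\<in>branchings \<Delta> i. scale (struct_coeff \<Delta> i i0 I)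
         (gen i0 * ((\<Prod>k\<in>#I. S (gen k)) - (\<Prod>k\<in>#I. ?A k))))"
    unfolding sum_trees_upto_Suc[OF bi rh Suc.prems] antipode_gen[OF hopf rh Suc.prems]
    by (simp add: case_prod_unfold right_diff_distrib scale_diff sum_subtractf)
  moreover have "vanishes_below (Suc h) (scale (struct_coeff \<Delta> i i0 I)
      (gen i0 * ((\<Prod>k\<in>#I. S (gen k)) - (\<Prod>k\<in>#I. ?A k))))"
    if "(i0, I) \<in> branchings \<Delta> i" for i0 I
  proof -
    have "vanishes_below h ((\<Prod>k\<in>#I. S (gen k)) - (\<Prod>k\<in>#I. ?A k))"
      using branchings_in(2)[OF bi rh Suc.prems that] Suc.IH
      by (intro vanishes_below_prod_diff) blast
    then show ?thesis
      using vanishes_below_mult[OF vanishes_below_gen, of h]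
      by (intro vanishes_below_scale) simp
  qed
  ultimately show ?case
    by (auto intro!: vanishes_below_uminus vanishes_below_sum)
qed simp

theorem theorem8:
  fixes X :: "nat set" and n :: nat
    and \<Delta> :: "'k::field_char_0 pol \<Rightarrow> 'k pol2"
    and S :: "'k pol \<Rightarrow> 'k pol"
  assumes "X = {1..n} \<or> X = {1..}"
    and "polynomial_hopf_algebra X \<Delta> S"
    and "right_handed X \<Delta>"
    and "conilpotent X \<Delta>"
    and "i \<in> X"
  shows "has_formal_sum
           (\<lambda>T. scale ((-1) ^ tree_length T * tree_coeff \<Delta> T) (b_value T))
           (trees_of X i)
           (S (gen i))"
  unfolding has_formal_sum_def
proof (intro allI conjI)
  fix m
  \<comment> \<open>Agreement below degree \<open>?h\<close> has to cover the degree of \<open>m\<close> itself.\<close>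
  let ?h = "Suc (monom_degree m)"
  let ?A = "trees_upto \<Delta> ?h i" and ?N = "{T \<in> trees_of X i. lookup (tree_term \<Delta> T) m \<noteq> 0}"
  have bi: "polynomial_bialgebra X \<Delta>"
    using assms(2) by (simp add: polynomial_hopf_algebra_def)
  note fin = finite_trees_upto[OF bi assms(3,5)]
  have sub: "?N \<subseteq> ?A"
  proof
    fix T assume "T \<in> ?N"
    then have T: "decorated_tree X T" "root_index T = i" "lookup (tree_term \<Delta> T) m \<noteq> 0"
      by (auto simp: trees_of_def)
    show "T \<in> ?A"
      using in_trees_upto[OF T(1) lookup_tree_term_nonzero(1)[OF T(3)], of ?h]
        lookup_tree_term_nonzero(2)[OF T(3)] T(2) by simp
  qed
  then show "finite ?N" using fin by (rule finite_subset)
  have "m \<notin> keys (S (gen i) - (\<Sum>T\<in>?A. tree_term \<Delta> T))"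
    using antipode_agrees_with_trees_upto[OF assms(2,3,5), of ?h] by (auto simp only: vanishes_below_def)
  then have "lookup (S (gen i)) m = (\<Sum>T\<in>?A. lookup (tree_term \<Delta> T) m)"
    by (simp only: in_keys_iff lookup_minus lookup_sum) simp
  also have "\<dots> = (\<Sum>T\<in>?N. lookup (tree_term \<Delta> T) m)"
    using sub trees_upto_subset[OF bi assms(3,5), of ?h] fin
    by (intro sum.mono_neutral_right) blast+
  finally show "lookup (S (gen i)) m = (\<Sum>T\<in>?N. lookup (tree_term \<Delta> T) m)" .
qed

end
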